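(* Let $(A,B)$ be a $[0,1]^2$-valued random vector and let $a,b>0$. Then the random equation $$X \overset{d}{=} AX + B(1-X), \qquad X \text{ independent of } (A,B),$$ has solution $X\sim\beta(a,b)$ if and only if the relation $$V_1 \overset{d}{=} AV_1 + BV_2, \qquad V_1, V_2, (A,B) \text{ mutually independent},$$ holds for $(V_1,V_2)\sim \Gamma_a\otimes\Gamma_b$.
   Context: $\overset{d}{=}$ denotes equality in distribution. $\beta(a,b)$, $a,b>0$, is the beta distribution on $(0,1)$ with density $B(a,b)^{-1}u^{a-1}(1-u)^{b-1}$, where $B(a,b)$ is the beta function. $\Gamma_a$, $a>0$, is the gamma distribution with shape $a$ and scale $1$, with density $u^{a-1}e^{-u}/\Gamma(a)$ on $(0,\infty)$. $F_1\otimes F_2$ denotes the joint law of independent random variables with laws $F_1$, $F_2$. *)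

theory Defs
  imports "HOL-Probability.Probability"
begin

definition beta_density :: "real \<Rightarrow> real \<Rightarrow> real \<Rightarrow> real" where
  "beta_density a b u =
     (if 0 < u \<and> u < 1 then u powr (a - 1) * (1 - u) powr (b - 1) / Beta a b else 0)"

definition beta_distribution :: "real \<Rightarrow> real \<Rightarrow> real measure" where
  "beta_distribution a b = density lborel (\<lambda>u. ennreal (beta_density a b u))"

definition gamma_density :: "real \<Rightarrow> real \<Rightarrow> real" where
  "gamma_density a u = (if 0 < u then u powr (a - 1) * exp (- u) / Gamma a else 0)"

definition gamma_distribution :: "real \<Rightarrow> real measure" where
  "gamma_distribution a = density lborel (\<lambda>u. ennreal (gamma_density a u))"

(* The sigma-algebra generated by a random variable. Independence is stated through these
   because indep_var and indep_vars need random variables with values in one common type,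
   whereas here a pair has to be independent of real random variables. *)
definition generated_sigma :: "'w measure \<Rightarrow> ('w \<Rightarrow> 'v::topological_space) \<Rightarrow> 'w set set" where
  "generated_sigma N Y = sets (vimage_algebra (space N) Y borel)"

(* The equation X = A X + B (1 - X) in law, X independent of (A, B), where nu is the law of
   (A, B) and F the law of X. Only laws matter, so (A, B) is replaced by a copy living on a
   space that also carries X; fixing the type of that space is no restriction, see
   has_solution_law_iff. *)
definition has_solution_law :: "(real \<times> real) measure \<Rightarrow> real measure \<Rightarrow> bool" where
  "has_solution_law \<nu> F \<longleftrightarrow>
     (\<exists>(N :: ((real \<times> real) \<times> real) measure) A B X.
        prob_space N \<and>
        A \<in> borel_measurable N \<and> B \<in> borel_measurable N \<and> X \<in> borel_measurable N \<and>
        distr N borel (\<lambda>\<omega>. (A \<omega>, B \<omega>)) = \<nu> \<and>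
        distr N borel X = F \<and>
        prob_space.indep_set N (generated_sigma N X) (generated_sigma N (\<lambda>\<omega>. (A \<omega>, B \<omega>))) \<and>
        distr N borel X = distr N borel (\<lambda>\<omega>. A \<omega> * X \<omega> + B \<omega> * (1 - X \<omega>)))"

(* The relation V1 = A V1 + B V2 in law, with V1, V2, (A, B) mutually independent, where nu is
   the law of (A, B) and G the joint law of (V1, V2); see gamma_type_relation_iff for the
   choice of the underlying space. *)
definition gamma_type_relation :: "(real \<times> real) measure \<Rightarrow> (real \<times> real) measure \<Rightarrow> bool" where
  "gamma_type_relation \<nu> G \<longleftrightarrow>
     (\<exists>(N :: ((real \<times> real) \<times> (real \<times> real)) measure) A B V\<^sub>1 V\<^sub>2.
        prob_space N \<and>
        A \<in> borel_measurable N \<and> B \<in> borel_measurable N \<and>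
        V\<^sub>1 \<in> borel_measurable N \<and> V\<^sub>2 \<in> borel_measurable N \<and>
        distr N borel (\<lambda>\<omega>. (A \<omega>, B \<omega>)) = \<nu> \<and>
        distr N (borel \<Otimes>\<^sub>M borel) (\<lambda>\<omega>. (V\<^sub>1 \<omega>, V\<^sub>2 \<omega>)) = G \<and>
        prob_space.indep_sets N
          (\<lambda>i. [generated_sigma N V\<^sub>1, generated_sigma N V\<^sub>2,
                generated_sigma N (\<lambda>\<omega>. (A \<omega>, B \<omega>))] ! i) {..<3} \<and>
        distr N borel V\<^sub>1 = distr N borel (\<lambda>\<omega>. A \<omega> * V\<^sub>1 \<omega> + B \<omega> * V\<^sub>2 \<omega>))"

lemma sets_generated_sigma:
  "generated_sigma N Y = {Y -` S \<inter> space N | S. S \<in> sets borel}"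
  unfolding generated_sigma_def by (simp add: sets_vimage_algebra2)

lemma (in prob_space) indep_set_generated_sigma_iff:
  fixes Y :: "'a \<Rightarrow> 'v::second_countable_topology"
    and Z :: "'a \<Rightarrow> 'u::second_countable_topology"
  assumes [measurable]: "Y \<in> borel_measurable M" "Z \<in> borel_measurable M"
  shows "indep_set (generated_sigma M Y) (generated_sigma M Z) \<longleftrightarrow>
    distr M borel (\<lambda>\<omega>. (Y \<omega>, Z \<omega>)) = distr M borel Y \<Otimes>\<^sub>M distr M borel Z" (is "?L \<longleftrightarrow> ?R")
proof
  interpret Y: prob_space "distr M borel Y" by (rule prob_space_distr) simp
  interpret Z: prob_space "distr M borel Z" by (rule prob_space_distr) simp
  have m: "(\<lambda>\<omega>. (Y \<omega>, Z \<omega>)) \<in> borel_measurable M"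
    by (simp flip: borel_prod)
  have sp: "sets (borel :: ('v \<times> 'u) measure) = sets (borel \<Otimes>\<^sub>M borel)" by (simp flip: borel_prod)
  {
    assume L: ?L
    have "distr M borel Y \<Otimes>\<^sub>M distr M borel Z = distr M borel (\<lambda>\<omega>. (Y \<omega>, Z \<omega>))"
    proof (rule pair_measure_eqI)
      fix S T assume "S \<in> sets (distr M borel Y)" "T \<in> sets (distr M borel Z)"
      then have S: "S \<in> sets borel" and T: "T \<in> sets borel" by auto
      have "S \<times> T \<in> sets borel" using S T by (simp add: sp)
      then have "emeasure (distr M borel (\<lambda>\<omega>. (Y \<omega>, Z \<omega>))) (S \<times> T)
          = emeasure M ((Y -` S \<inter> space M) \<inter> (Z -` T \<inter> space M))"
        using m by (subst emeasure_distr) (auto intro!: arg_cong[where f="emeasure M"])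
      also have "\<dots> = prob (Y -` S \<inter> space M) * prob (Z -` T \<inter> space M)"
        using indep_setD[OF L, of "Y -` S \<inter> space M" "Z -` T \<inter> space M"] S T
        by (auto simp: emeasure_eq_measure sets_generated_sigma)
      finally show "emeasure (distr M borel Y) S * emeasure (distr M borel Z) T =
          emeasure (distr M borel (\<lambda>\<omega>. (Y \<omega>, Z \<omega>))) (S \<times> T)"
        using S T by (simp add: emeasure_distr emeasure_eq_measure ennreal_mult)
    qed (use Y.sigma_finite_measure_axioms Z.sigma_finite_measure_axioms in
        \<open>simp_all add: sp cong: sets_pair_measure_cong\<close>)
    then show ?R by simp
  }
  {
    assume R: ?R
    show ?L
    proof (rule indep_setI)
      show "generated_sigma M Y \<subseteq> events" "generated_sigma M Z \<subseteq> events"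
        by (auto simp: sets_generated_sigma)
    next
      fix a b assume "a \<in> generated_sigma M Y" "b \<in> generated_sigma M Z"
      then obtain S T where S: "S \<in> sets borel" "a = Y -` S \<inter> space M"
        and T: "T \<in> sets borel" "b = Z -` T \<inter> space M"
        by (auto simp: sets_generated_sigma)
      have "S \<times> T \<in> sets borel" using S T by (simp add: sp)
      then have "emeasure M (a \<inter> b) = emeasure (distr M borel (\<lambda>\<omega>. (Y \<omega>, Z \<omega>))) (S \<times> T)"
        using m S T by (subst emeasure_distr) (auto intro!: arg_cong[where f="emeasure M"])
      also have "\<dots> = emeasure M a * emeasure M b"
        unfolding R using S T by (simp add: Z.emeasure_pair_measure_Times emeasure_distr)
      finally show "prob (a \<inter> b) = prob a * prob b"
        by (simp add: emeasure_eq_measure flip: ennreal_mult)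
    qed
  }
qed

lemma (in prob_space) indep_sets3_iff:
  assumes sub: "F\<^sub>1 \<subseteq> events" "F\<^sub>2 \<subseteq> events" "F\<^sub>3 \<subseteq> events"
    and sp: "space M \<in> F\<^sub>1" "space M \<in> F\<^sub>2" "space M \<in> F\<^sub>3"
  shows "indep_sets (\<lambda>i. [F\<^sub>1, F\<^sub>2, F\<^sub>3] ! i) {..<3} \<longleftrightarrow>
    (\<forall>S\<^sub>1\<in>F\<^sub>1. \<forall>S\<^sub>2\<in>F\<^sub>2. \<forall>S\<^sub>3\<in>F\<^sub>3.
       prob (S\<^sub>1 \<inter> (S\<^sub>2 \<inter> S\<^sub>3)) = prob S\<^sub>1 * (prob S\<^sub>2 * prob S\<^sub>3))" (is "?L \<longleftrightarrow> ?R")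
proof -
  have I: "{..<3::nat} = {0, 1, 2}" by auto
  have "?L \<longleftrightarrow> (\<forall>S\<in>(\<Pi> i\<in>{..<3}. [F\<^sub>1, F\<^sub>2, F\<^sub>3] ! i).
      prob (\<Inter>j\<in>{..<3}. S j) = (\<Prod>j\<in>{..<3}. prob (S j)))"
    by (rule indep_sets_finite) (use sub sp in \<open>auto simp: I\<close>)
  also have "\<dots> \<longleftrightarrow> ?R"
  proof (intro iffI ballI)
    fix S\<^sub>1 S\<^sub>2 S\<^sub>3
    assume *: "\<forall>S\<in>(\<Pi> i\<in>{..<3}. [F\<^sub>1, F\<^sub>2, F\<^sub>3] ! i).
        prob (\<Inter>j\<in>{..<3}. S j) = (\<Prod>j\<in>{..<3}. prob (S j))"
      and "S\<^sub>1 \<in> F\<^sub>1" "S\<^sub>2 \<in> F\<^sub>2" "S\<^sub>3 \<in> F\<^sub>3"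
    then show "prob (S\<^sub>1 \<inter> (S\<^sub>2 \<inter> S\<^sub>3)) = prob S\<^sub>1 * (prob S\<^sub>2 * prob S\<^sub>3)"
      using bspec[OF *, of "\<lambda>i. [S\<^sub>1, S\<^sub>2, S\<^sub>3] ! i"] by (auto simp: I mult.assoc)
  next
    fix S assume "?R" "S \<in> (\<Pi> i\<in>{..<3}. [F\<^sub>1, F\<^sub>2, F\<^sub>3] ! i)"
    then show "prob (\<Inter>j\<in>{..<3}. S j) = (\<Prod>j\<in>{..<3}. prob (S j))"
      by (auto simp: I Pi_iff mult.assoc)
  qed
  finally show ?thesis .
qed

lemma (in prob_space) generated_sigma_Pair:
  fixes Y :: "'a \<Rightarrow> 'v::second_countable_topology"
    and Z :: "'a \<Rightarrow> 'u::second_countable_topology"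
  shows "generated_sigma M (\<lambda>\<omega>. (Y \<omega>, Z \<omega>)) =
    sigma_sets (space M) {S \<inter> T | S T. S \<in> generated_sigma M Y \<and> T \<in> generated_sigma M Z}"
proof -
  let ?p = "\<lambda>\<omega>. (Y \<omega>, Z \<omega>)"
  let ?R = "{S \<times> T | S T. S \<in> sets (borel :: 'v measure) \<and> T \<in> sets (borel :: 'u measure)}"
  have "generated_sigma M ?p = {?p -` S \<inter> space M | S. S \<in> sigma_sets UNIV ?R}"
    by (simp add: sets_generated_sigma sets_pair_measure flip: borel_prod)
  also have "\<dots> = sigma_sets (space M) {?p -` S \<inter> space M | S. S \<in> ?R}"
    by (rule sigma_sets_vimage_commute) auto
  also have "{?p -` S \<inter> space M | S. S \<in> ?R} =
      {S \<inter> T | S T. S \<in> generated_sigma M Y \<and> T \<in> generated_sigma M Z}" (is "?A = ?B")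
  proof (intro set_eqI iffI)
    fix x assume "x \<in> ?A"
    then obtain S T where "S \<in> sets borel" "T \<in> sets borel" "x = ?p -` (S \<times> T) \<inter> space M" by blast
    then show "x \<in> ?B"
      by (intro CollectI exI[of _ "Y -` S \<inter> space M"] exI[of _ "Z -` T \<inter> space M"])
        (auto simp: sets_generated_sigma)
  next
    fix x assume "x \<in> ?B"
    then obtain S T where "S \<in> sets borel" "T \<in> sets borel"
      "x = (Y -` S \<inter> space M) \<inter> (Z -` T \<inter> space M)" by (auto simp: sets_generated_sigma)
    then show "x \<in> ?A"
      by (intro CollectI exI[of _ "S \<times> T"]) auto
  qed
  finally show ?thesis .
qed

lemma (in prob_space) indep_sets3_generated_sigma_iff:
  fixes U :: "'a \<Rightarrow> 't::second_countable_topology"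
    and Y :: "'a \<Rightarrow> 'v::second_countable_topology"
    and Z :: "'a \<Rightarrow> 'u::second_countable_topology"
  assumes [measurable]: "U \<in> borel_measurable M" "Y \<in> borel_measurable M" "Z \<in> borel_measurable M"
  shows "indep_sets (\<lambda>i. [generated_sigma M U, generated_sigma M Y, generated_sigma M Z] ! i) {..<3} \<longleftrightarrow>
    distr M borel (\<lambda>\<omega>. (U \<omega>, Y \<omega>, Z \<omega>)) =
      distr M borel U \<Otimes>\<^sub>M (distr M borel Y \<Otimes>\<^sub>M distr M borel Z)" (is "?L \<longleftrightarrow> ?R")
proof -
  let ?U = "generated_sigma M U" and ?Y = "generated_sigma M Y" and ?Z = "generated_sigma M Z"
  let ?YZ = "generated_sigma M (\<lambda>\<omega>. (Y \<omega>, Z \<omega>))"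
  interpret U: prob_space "distr M borel U" by (rule prob_space_distr) simp
  interpret Y: prob_space "distr M borel Y" by (rule prob_space_distr) simp
  interpret Z: prob_space "distr M borel Z" by (rule prob_space_distr) simp
  interpret YZ: pair_prob_space "distr M borel Y" "distr M borel Z" ..
  have p: "(\<lambda>\<omega>. (Y \<omega>, Z \<omega>)) \<in> borel_measurable M" by (simp flip: borel_prod)
  have p3: "(\<lambda>\<omega>. (U \<omega>, Y \<omega>, Z \<omega>)) \<in> borel_measurable M" by (simp flip: borel_prod)
  have sp: "space M \<in> generated_sigma M V" for V :: "'a \<Rightarrow> 's::topological_space"
    by (auto simp: sets_generated_sigma intro!: exI[of _ UNIV])
  have ev: "generated_sigma M V \<subseteq> events" if [measurable]: "V \<in> borel_measurable M"
    for V :: "'a \<Rightarrow> 's::topological_space"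
    by (auto simp: sets_generated_sigma)
  have cl: "S \<inter> T \<in> generated_sigma M V" if "S \<in> generated_sigma M V" "T \<in> generated_sigma M V"
    for S T and V :: "'a \<Rightarrow> 's::topological_space"
    using that unfolding generated_sigma_def by (rule sets.Int)
  have evp: "?YZ \<subseteq> events" by (rule ev[OF p])
  have L: "?L \<longleftrightarrow> (\<forall>S\<^sub>1\<in>?U. \<forall>S\<^sub>2\<in>?Y. \<forall>S\<^sub>3\<in>?Z.
       prob (S\<^sub>1 \<inter> (S\<^sub>2 \<inter> S\<^sub>3)) = prob S\<^sub>1 * (prob S\<^sub>2 * prob S\<^sub>3))"
    by (rule indep_sets3_iff) (rule sp ev assms)+
  have in_YZ: "S \<inter> T \<in> ?YZ" if "S \<in> ?Y" "T \<in> ?Z" for S T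
    unfolding generated_sigma_Pair using that by auto
  have "?L \<longleftrightarrow> indep_set ?U ?YZ \<and> indep_set ?Y ?Z"
  proof
    assume l: ?L
    have yz: "prob (S \<inter> T) = prob S * prob T" if "S \<in> ?Y" "T \<in> ?Z" for S T
    proof -
      have "prob (space M \<inter> (S \<inter> T)) = prob (space M) * (prob S * prob T)"
        using l that sp unfolding L by blast
      moreover have "S \<inter> T \<subseteq> space M" using in_YZ[OF that] evp sets.sets_into_space by blast
      ultimately show ?thesis by (simp add: Int_absorb1 prob_space)
    qed
    have "indep_set ?Y ?Z" by (rule indep_setI) (simp_all add: yz ev)
    moreover have "indep_set (sigma_sets (space M) ?U) (sigma_sets (space M)
        {S \<inter> T | S T. S \<in> ?Y \<and> T \<in> ?Z})"
    proof (rule indep_set_sigma_sets)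
      show "indep_set ?U {S \<inter> T | S T. S \<in> ?Y \<and> T \<in> ?Z}"
      proof (rule indep_setI)
        show "{S \<inter> T | S T. S \<in> ?Y \<and> T \<in> ?Z} \<subseteq> events" using in_YZ evp by blast
      qed (use l yz in \<open>auto simp: L ev[OF assms(1), THEN subsetD]\<close>)
      show "Int_stable ?U" by (auto intro!: Int_stableI cl)
      show "Int_stable {S \<inter> T | S T. S \<in> ?Y \<and> T \<in> ?Z}"
      proof (rule Int_stableI, clarify)
        fix S T S' T' assume "S \<in> ?Y" "T \<in> ?Z" "S' \<in> ?Y" "T' \<in> ?Z"
        then show "\<exists>S'' T''. S \<inter> T \<inter> (S' \<inter> T') = S'' \<inter> T'' \<and> S'' \<in> ?Y \<and> T'' \<in> ?Z"
          by (intro exI[of _ "S \<inter> S'"] exI[of _ "T \<inter> T'"]) (auto intro: cl)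
      qed
    qed
    moreover have "sigma_sets (space M) ?U = ?U"
      unfolding generated_sigma_def
      using sets.sigma_sets_eq[of "vimage_algebra (space M) U borel"] by simp
    ultimately show "indep_set ?U ?YZ \<and> indep_set ?Y ?Z"
      by (simp add: generated_sigma_Pair)
  next
    assume "indep_set ?U ?YZ \<and> indep_set ?Y ?Z"
    then show ?L unfolding L using in_YZ by (auto simp: indep_setD)
  qed
  also have "\<dots> \<longleftrightarrow> ?R"
  proof
    assume "indep_set ?U ?YZ \<and> indep_set ?Y ?Z"
    then show ?R using p by (simp add: indep_set_generated_sigma_iff)
  next
    assume r: ?R
    have "distr M borel (\<lambda>\<omega>. (Y \<omega>, Z \<omega>)) =
        distr (distr M borel (\<lambda>\<omega>. (U \<omega>, Y \<omega>, Z \<omega>))) borel snd"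
      using p3 by (subst distr_distr) (simp_all add: comp_def flip: borel_prod)
    also have "\<dots> = distr M borel Y \<Otimes>\<^sub>M distr M borel Z" unfolding r
    proof (rule measure_eqI)
      fix S assume "S \<in> sets (distr (distr M borel U \<Otimes>\<^sub>M (distr M borel Y \<Otimes>\<^sub>M distr M borel Z)) borel snd)"
      then have S: "S \<in> sets (distr M borel Y \<Otimes>\<^sub>M distr M borel Z)"
        by (simp cong: sets_pair_measure_cong flip: borel_prod)
      have "emeasure (distr (distr M borel U \<Otimes>\<^sub>M (distr M borel Y \<Otimes>\<^sub>M distr M borel Z)) borel snd) S =
          emeasure (distr M borel U \<Otimes>\<^sub>M (distr M borel Y \<Otimes>\<^sub>M distr M borel Z)) (UNIV \<times> S)"
        using S by (subst emeasure_distr)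
          (auto simp: space_pair_measure intro!: arg_cong2[where f=emeasure]
            simp flip: borel_prod cong: measurable_cong_sets sets_pair_measure_cong)
      also have "\<dots> = emeasure (distr M borel Y \<Otimes>\<^sub>M distr M borel Z) S"
        using S U.emeasure_space_1 by (subst YZ.emeasure_pair_measure_Times) auto
      finally show "emeasure (distr (distr M borel U \<Otimes>\<^sub>M (distr M borel Y \<Otimes>\<^sub>M distr M borel Z)) borel snd) S =
          emeasure (distr M borel Y \<Otimes>\<^sub>M distr M borel Z) S" .
    qed (simp cong: sets_pair_measure_cong flip: borel_prod)
    finally have yz: "distr M borel (\<lambda>\<omega>. (Y \<omega>, Z \<omega>)) = distr M borel Y \<Otimes>\<^sub>M distr M borel Z" .
    show "indep_set ?U ?YZ \<and> indep_set ?Y ?Z"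
      using r yz p by (simp add: indep_set_generated_sigma_iff)
  qed
  finally show ?thesis .
qed

lemma has_solution_law_iff:
  fixes A B X :: "'w \<Rightarrow> real"
  assumes M: "prob_space M"
    and meas [measurable]: "A \<in> borel_measurable M" "B \<in> borel_measurable M" "X \<in> borel_measurable M"
    and ind: "prob_space.indep_set M (generated_sigma M X) (generated_sigma M (\<lambda>\<omega>. (A \<omega>, B \<omega>)))"
  shows "has_solution_law (distr M borel (\<lambda>\<omega>. (A \<omega>, B \<omega>))) (distr M borel X) \<longleftrightarrow>
    distr M borel X = distr M borel (\<lambda>\<omega>. A \<omega> * X \<omega> + B \<omega> * (1 - X \<omega>))" (is "?L \<longleftrightarrow> ?R")
proof
  let ?f = "\<lambda>(x::real, (\<alpha>::real, \<beta>::real)). \<alpha> * x + \<beta> * (1 - x)"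
  have f: "?f \<in> borel_measurable borel" by (simp flip: borel_prod)
  have law: "distr N borel (\<lambda>\<omega>. A' \<omega> * X' \<omega> + B' \<omega> * (1 - X' \<omega>)) =
      distr (distr N borel X' \<Otimes>\<^sub>M distr N borel (\<lambda>\<omega>. (A' \<omega>, B' \<omega>))) borel ?f"
    if N: "prob_space N"
      and [measurable]: "A' \<in> borel_measurable N" "B' \<in> borel_measurable N" "X' \<in> borel_measurable N"
      and i: "prob_space.indep_set N (generated_sigma N X') (generated_sigma N (\<lambda>\<omega>. (A' \<omega>, B' \<omega>)))"
    for N :: "'x measure" and A' B' X'
  proof -
    interpret N: prob_space N by fact
    have p: "(\<lambda>\<omega>. (A' \<omega>, B' \<omega>)) \<in> borel_measurable N" by (simp flip: borel_prod)
    have p3: "(\<lambda>\<omega>. (X' \<omega>, A' \<omega>, B' \<omega>)) \<in> borel_measurable N" by (simp flip: borel_prod)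
    have "distr N borel X' \<Otimes>\<^sub>M distr N borel (\<lambda>\<omega>. (A' \<omega>, B' \<omega>)) =
        distr N borel (\<lambda>\<omega>. (X' \<omega>, A' \<omega>, B' \<omega>))"
      using i p by (simp add: N.indep_set_generated_sigma_iff)
    then show ?thesis
      using p3 f by (simp add: distr_distr comp_def)
  qed
  interpret M: prob_space M by (rule M)
  have p: "(\<lambda>\<omega>. (A \<omega>, B \<omega>)) \<in> borel_measurable M" by (simp flip: borel_prod)
  {
    assume ?L
    then obtain N :: "((real \<times> real) \<times> real) measure" and A' B' X' where N: "prob_space N"
      "A' \<in> borel_measurable N" "B' \<in> borel_measurable N" "X' \<in> borel_measurable N"
      "prob_space.indep_set N (generated_sigma N X') (generated_sigma N (\<lambda>\<omega>. (A' \<omega>, B' \<omega>)))"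
      and eq: "distr N borel (\<lambda>\<omega>. (A' \<omega>, B' \<omega>)) = distr M borel (\<lambda>\<omega>. (A \<omega>, B \<omega>))"
      "distr N borel X' = distr M borel X"
      "distr N borel X' = distr N borel (\<lambda>\<omega>. A' \<omega> * X' \<omega> + B' \<omega> * (1 - X' \<omega>))"
      unfolding has_solution_law_def by blast
    have "distr M borel X = distr N borel (\<lambda>\<omega>. A' \<omega> * X' \<omega> + B' \<omega> * (1 - X' \<omega>))"
      using eq(3) unfolding eq(2) .
    also have "\<dots> = distr (distr M borel X \<Otimes>\<^sub>M distr M borel (\<lambda>\<omega>. (A \<omega>, B \<omega>))) borel ?f"
      unfolding law[OF N] eq(1,2) ..
    also have "\<dots> = distr M borel (\<lambda>\<omega>. A \<omega> * X \<omega> + B \<omega> * (1 - X \<omega>))"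
      by (rule law[OF M meas ind, symmetric])
    finally show ?R .
  }
  {
    assume r: ?R
    define j where "j = (\<lambda>\<omega>. ((A \<omega>, B \<omega>), X \<omega>))"
    define N where "N = distr M borel j"
    have j: "j \<in> borel_measurable M" unfolding j_def by (simp flip: borel_prod)
    have N: "prob_space N" unfolding N_def by (rule M.prob_space_distr) (rule j)
    interpret N: prob_space N by (rule N)
    have tr: "distr N borel g = distr M borel (\<lambda>\<omega>. g (j \<omega>))" if "g \<in> borel_measurable borel"
      for g :: "(real \<times> real) \<times> real \<Rightarrow> 's::topological_space"
      unfolding N_def using that j by (simp add: distr_distr comp_def)
    have mN: "g \<in> borel_measurable N" if "g \<in> borel_measurable borel"
      for g :: "(real \<times> real) \<times> real \<Rightarrow> 's::topological_space"
      unfolding N_def using that by simp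
    let ?A = "\<lambda>w::(real \<times> real) \<times> real. fst (fst w)" and ?B = "\<lambda>w::(real \<times> real) \<times> real. snd (fst w)"
      and ?X = "\<lambda>w::(real \<times> real) \<times> real. snd w"
    have m: "?A \<in> borel_measurable borel" "?B \<in> borel_measurable borel" "?X \<in> borel_measurable borel"
      "(\<lambda>w. (?A w, ?B w)) \<in> borel_measurable borel" "(\<lambda>w. (?X w, ?A w, ?B w)) \<in> borel_measurable borel"
      "(\<lambda>w. ?A w * ?X w + ?B w * (1 - ?X w)) \<in> borel_measurable borel"
      by (simp_all flip: borel_prod)
    have "distr M borel (\<lambda>\<omega>. (X \<omega>, A \<omega>, B \<omega>)) =
        distr M borel X \<Otimes>\<^sub>M distr M borel (\<lambda>\<omega>. (A \<omega>, B \<omega>))"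
      using ind p by (simp add: M.indep_set_generated_sigma_iff)
    then have "N.indep_set (generated_sigma N ?X) (generated_sigma N (\<lambda>w. (?A w, ?B w)))"
      by (subst N.indep_set_generated_sigma_iff) (simp_all add: m[THEN mN] m[THEN tr] j_def del: prod.collapse)
    then show ?L
      unfolding has_solution_law_def using r
      by (intro exI[of _ N] exI[of _ ?A] exI[of _ ?B] exI[of _ ?X] conjI N)
        (simp_all add: m[THEN mN] m[THEN tr] j_def del: prod.collapse)
  }
qed

lemma gamma_type_relation_iff:
  fixes A B V\<^sub>1 V\<^sub>2 :: "'w \<Rightarrow> real"
  assumes M: "prob_space M"
    and meas [measurable]: "A \<in> borel_measurable M" "B \<in> borel_measurable M"
      "V\<^sub>1 \<in> borel_measurable M" "V\<^sub>2 \<in> borel_measurable M"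
    and ind: "prob_space.indep_sets M
      (\<lambda>i. [generated_sigma M V\<^sub>1, generated_sigma M V\<^sub>2,
            generated_sigma M (\<lambda>\<omega>. (A \<omega>, B \<omega>))] ! i) {..<3}"
  shows "gamma_type_relation (distr M borel (\<lambda>\<omega>. (A \<omega>, B \<omega>)))
      (distr M (borel \<Otimes>\<^sub>M borel) (\<lambda>\<omega>. (V\<^sub>1 \<omega>, V\<^sub>2 \<omega>))) \<longleftrightarrow>
    distr M borel V\<^sub>1 = distr M borel (\<lambda>\<omega>. A \<omega> * V\<^sub>1 \<omega> + B \<omega> * V\<^sub>2 \<omega>)" (is "?L \<longleftrightarrow> ?R")
proof
  let ?f = "\<lambda>(v::real, w::real, (\<alpha>::real, \<beta>::real)). \<alpha> * v + \<beta> * w"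
  have f: "?f \<in> borel_measurable borel" by (simp flip: borel_prod)
  have law: "distr N borel (\<lambda>\<omega>. A' \<omega> * V' \<omega> + B' \<omega> * W' \<omega>) =
      distr (distr N borel V' \<Otimes>\<^sub>M (distr N borel W' \<Otimes>\<^sub>M distr N borel (\<lambda>\<omega>. (A' \<omega>, B' \<omega>)))) borel ?f"
    "distr N borel V' = distr (distr N (borel \<Otimes>\<^sub>M borel) (\<lambda>\<omega>. (V' \<omega>, W' \<omega>))) borel fst"
    "distr N borel W' = distr (distr N (borel \<Otimes>\<^sub>M borel) (\<lambda>\<omega>. (V' \<omega>, W' \<omega>))) borel snd"
    if N: "prob_space N"
      and [measurable]: "A' \<in> borel_measurable N" "B' \<in> borel_measurable N"
        "V' \<in> borel_measurable N" "W' \<in> borel_measurable N"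
      and i: "prob_space.indep_sets N
        (\<lambda>i. [generated_sigma N V', generated_sigma N W',
            generated_sigma N (\<lambda>\<omega>. (A' \<omega>, B' \<omega>))] ! i) {..<3}"
    for N :: "'x measure" and A' B' V' W'
  proof -
    interpret N: prob_space N by fact
    have p: "(\<lambda>\<omega>. (A' \<omega>, B' \<omega>)) \<in> borel_measurable N" by (simp flip: borel_prod)
    have p4: "(\<lambda>\<omega>. (V' \<omega>, W' \<omega>, A' \<omega>, B' \<omega>)) \<in> borel_measurable N" by (simp flip: borel_prod)
    have "distr N borel V' \<Otimes>\<^sub>M (distr N borel W' \<Otimes>\<^sub>M distr N borel (\<lambda>\<omega>. (A' \<omega>, B' \<omega>))) =
        distr N borel (\<lambda>\<omega>. (V' \<omega>, W' \<omega>, A' \<omega>, B' \<omega>))"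
      using i p by (simp add: N.indep_sets3_generated_sigma_iff)
    then show "distr N borel (\<lambda>\<omega>. A' \<omega> * V' \<omega> + B' \<omega> * W' \<omega>) =
      distr (distr N borel V' \<Otimes>\<^sub>M (distr N borel W' \<Otimes>\<^sub>M distr N borel (\<lambda>\<omega>. (A' \<omega>, B' \<omega>)))) borel ?f"
      using p4 f by (simp add: distr_distr comp_def)
  qed (simp_all add: distr_distr comp_def)
  interpret M: prob_space M by (rule M)
  have p: "(\<lambda>\<omega>. (A \<omega>, B \<omega>)) \<in> borel_measurable M" by (simp flip: borel_prod)
  {
    assume ?L
    then obtain N :: "((real \<times> real) \<times> (real \<times> real)) measure" and A' B' V' W' where N: "prob_space N"
      "A' \<in> borel_measurable N" "B' \<in> borel_measurable N"
      "V' \<in> borel_measurable N" "W' \<in> borel_measurable N"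
      "prob_space.indep_sets N
        (\<lambda>i. [generated_sigma N V', generated_sigma N W',
            generated_sigma N (\<lambda>\<omega>. (A' \<omega>, B' \<omega>))] ! i) {..<3}"
      and eq: "distr N borel (\<lambda>\<omega>. (A' \<omega>, B' \<omega>)) = distr M borel (\<lambda>\<omega>. (A \<omega>, B \<omega>))"
      "distr N (borel \<Otimes>\<^sub>M borel) (\<lambda>\<omega>. (V' \<omega>, W' \<omega>)) = distr M (borel \<Otimes>\<^sub>M borel) (\<lambda>\<omega>. (V\<^sub>1 \<omega>, V\<^sub>2 \<omega>))"
      and r: "distr N borel V' = distr N borel (\<lambda>\<omega>. A' \<omega> * V' \<omega> + B' \<omega> * W' \<omega>)"
      unfolding gamma_type_relation_def by blast
    have V: "distr N borel V' = distr M borel V\<^sub>1"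
      by (rule trans[OF law(2)[OF N]]) (unfold eq(2), rule law(2)[OF M meas ind, symmetric])
    have W: "distr N borel W' = distr M borel V\<^sub>2"
      by (rule trans[OF law(3)[OF N]]) (unfold eq(2), rule law(3)[OF M meas ind, symmetric])
    have "distr M borel V\<^sub>1 = distr N borel (\<lambda>\<omega>. A' \<omega> * V' \<omega> + B' \<omega> * W' \<omega>)"
      using r unfolding V .
    also have "\<dots> = distr (distr M borel V\<^sub>1 \<Otimes>\<^sub>M
        (distr M borel V\<^sub>2 \<Otimes>\<^sub>M distr M borel (\<lambda>\<omega>. (A \<omega>, B \<omega>)))) borel ?f"
      unfolding law(1)[OF N] eq(1) V W ..
    also have "\<dots> = distr M borel (\<lambda>\<omega>. A \<omega> * V\<^sub>1 \<omega> + B \<omega> * V\<^sub>2 \<omega>)"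
      by (rule law(1)[OF M meas ind, symmetric])
    finally show ?R .
  }
  {
    assume r: ?R
    define j where "j = (\<lambda>\<omega>. ((A \<omega>, B \<omega>), (V\<^sub>1 \<omega>, V\<^sub>2 \<omega>)))"
    define N where "N = distr M borel j"
    have j: "j \<in> borel_measurable M" unfolding j_def by (simp flip: borel_prod)
    have N: "prob_space N" unfolding N_def by (rule M.prob_space_distr) (rule j)
    interpret N: prob_space N by (rule N)
    have tr: "distr N borel g = distr M borel (\<lambda>\<omega>. g (j \<omega>))" if "g \<in> borel_measurable borel"
      for g :: "(real \<times> real) \<times> (real \<times> real) \<Rightarrow> 's::topological_space"
      unfolding N_def using that j by (simp add: distr_distr comp_def)
    have mN: "g \<in> borel_measurable N" if "g \<in> borel_measurable borel"
      for g :: "(real \<times> real) \<times> (real \<times> real) \<Rightarrow> 's::topological_space"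
      unfolding N_def using that by simp
    let ?A = "\<lambda>w::(real \<times> real) \<times> (real \<times> real). fst (fst w)"
      and ?B = "\<lambda>w::(real \<times> real) \<times> (real \<times> real). snd (fst w)"
      and ?V = "\<lambda>w::(real \<times> real) \<times> (real \<times> real). fst (snd w)"
      and ?W = "\<lambda>w::(real \<times> real) \<times> (real \<times> real). snd (snd w)"
    have m: "?A \<in> borel_measurable borel" "?B \<in> borel_measurable borel"
      "?V \<in> borel_measurable borel" "?W \<in> borel_measurable borel"
      "(\<lambda>w. (?A w, ?B w)) \<in> borel_measurable borel" "(\<lambda>w. (?V w, ?W w)) \<in> borel_measurable borel"
      "(\<lambda>w. (?V w, ?W w, ?A w, ?B w)) \<in> borel_measurable borel"
      "(\<lambda>w. ?A w * ?V w + ?B w * ?W w) \<in> borel_measurable borel"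
      by (simp_all flip: borel_prod)
    have "distr M borel (\<lambda>\<omega>. (V\<^sub>1 \<omega>, V\<^sub>2 \<omega>, A \<omega>, B \<omega>)) =
        distr M borel V\<^sub>1 \<Otimes>\<^sub>M (distr M borel V\<^sub>2 \<Otimes>\<^sub>M distr M borel (\<lambda>\<omega>. (A \<omega>, B \<omega>)))"
      using ind p by (simp add: M.indep_sets3_generated_sigma_iff)
    then have "N.indep_sets
        (\<lambda>i. [generated_sigma N ?V, generated_sigma N ?W,
            generated_sigma N (\<lambda>w. (?A w, ?B w))] ! i) {..<3}"
      by (subst N.indep_sets3_generated_sigma_iff) (simp_all add: m[THEN mN] m[THEN tr] j_def del: prod.collapse)
    then show ?L
      unfolding gamma_type_relation_def borel_prod using r
      by (intro exI[of _ N] exI[of _ ?A] exI[of _ ?B] exI[of _ ?V] exI[of _ ?W] conjI N)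
        (simp_all add: m[THEN mN] m[THEN tr] j_def del: prod.collapse)
  }
qed

end

theory Submission
  imports Defs
begin

text \<open>
  If \<open>S \<sim> \<Gamma>\<^bsub>a+b\<^esub>\<close> and \<open>X \<sim> \<beta>(a,b)\<close> are independent, then \<open>(S X, S (1 - X))\<close> has law
  \<open>\<Gamma>\<^bsub>a\<^esub> \<otimes> \<Gamma>\<^bsub>b\<^esub>\<close>. So the gamma relation reads \<open>S X = S (A X + B (1 - X))\<close> in law, with \<open>S\<close>
  independent of \<open>(X, A, B)\<close>. Since the moments of \<open>S\<close> are finite and nonzero, and the
  laws of \<open>X\<close> and \<open>A X + B (1 - X)\<close> live on \<open>[0,1]\<close>, where moments determine the law, the factor
  \<open>S\<close> can be cancelled.
\<close>

section \<open>Moments of laws on the unit interval and cancellation of an independent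
  factor\<close>

text \<open>\<open>char_approx1\<close> bounds the Taylor remainder of the characteristic function
  by \<open>2 * \<bar>t\<bar>^n / fact n\<close> times the \<open>n\<close>-th absolute moment, and
  on the unit interval that moment is at most 1.\<close>

lemma char_unit_interval_approx:
  assumes "real_distribution \<mu>" and unit: "AE x in \<mu>. x \<in> {0..1}"
  shows "cmod (char \<mu> t - (\<Sum>k\<le>n. ((\<i> * t)^k / fact k) * (\<integral>x. x^k \<partial>\<mu>))) \<le> 2 * (\<bar>t\<bar>^n / fact n)"
    and "integrable \<mu> (\<lambda>x. x^n)"
proof -
  interpret real_distribution \<mu> by fact
  have int: "integrable \<mu> (\<lambda>x. x^k)" for k
    by (rule integrable_const_bound[of _ 1])
      (use unit in eventually_elim, auto intro: power_le_one)
  then show "integrable \<mu> (\<lambda>x. x^n)" .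
  have "(\<integral>x. \<bar>x\<bar>^n \<partial>\<mu>) \<le> (\<integral>x. 1 \<partial>\<mu>)"
    by (rule integral_mono_AE)
      (use int[of n, THEN integrable_abs] in \<open>simp_all add: power_abs\<close>,
        use unit in eventually_elim, auto intro: power_le_one)
  then have "(\<integral>x. \<bar>x\<bar>^n \<partial>\<mu>) \<le> 1" using prob_space by simp
  then have "(2 * \<bar>t\<bar>^n / fact n) * (\<integral>x. \<bar>x\<bar>^n \<partial>\<mu>) \<le> (2 * \<bar>t\<bar>^n / fact n) * 1"
    by (intro mult_left_mono) auto
  with char_approx1[of n t, OF int]
  show "cmod (char \<mu> t - (\<Sum>k\<le>n. ((\<i> * t)^k / fact k) * (\<integral>x. x^k \<partial>\<mu>))) \<le> 2 * (\<bar>t\<bar>^n / fact n)"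
    by simp
qed

text \<open>Equal moments give equal Taylor polynomials, so for every \<open>n\<close> the
  characteristic functions differ by at most the two remainder bounds together. These tend to 0, and
  Levy's uniqueness theorem concludes.\<close>

lemma moments_determine_unit_interval_law:
  assumes \<mu>: "real_distribution \<mu>" "AE x in \<mu>. x \<in> {0..1}"
    and \<nu>: "real_distribution \<nu>" "AE x in \<nu>. x \<in> {0..1}"
    and mom: "\<And>n::nat. (\<integral>x. x^n \<partial>\<mu>) = (\<integral>x. x^n \<partial>\<nu>)"
  shows "\<mu> = \<nu>"
proof (rule Levy_uniqueness[OF \<mu>(1) \<nu>(1)], rule ext)
  fix t :: real
  have bound: "cmod (char \<mu> t - char \<nu> t) \<le> 4 * (\<bar>t\<bar>^n / fact n)" for n
  proof -
    let ?s = "\<Sum>k\<le>n. ((\<i> * t)^k / fact k) * (\<integral>x. x^k \<partial>\<mu>)"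
    have "cmod (char \<mu> t - char \<nu> t) \<le> cmod (char \<mu> t - ?s) + cmod (char \<nu> t - ?s)"
      using norm_triangle_ineq4[of "char \<mu> t - ?s" "char \<nu> t - ?s"] by simp
    also have "\<dots> \<le> 4 * (\<bar>t\<bar>^n / fact n)"
      using char_unit_interval_approx(1)[OF \<mu>, of t n] char_unit_interval_approx(1)[OF \<nu>, of t n]
      by (simp add: mom)
    finally show ?thesis .
  qed
  \<comment> \<open>Up to the factor 4 these are the terms of the convergent exponential series at
    \<open>\<bar>t\<bar>\<close>.\<close>
  have "(\<lambda>n. 4 * (\<bar>t\<bar>^n / fact n)) \<longlonglongrightarrow> 4 * 0"
    using summable_exp[of "\<bar>t\<bar>"]
    by (intro tendsto_mult tendsto_const summable_LIMSEQ_zero) (simp add: field_simps)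
  then have "cmod (char \<mu> t - char \<nu> t) \<le> 0"
    by (intro LIMSEQ_le_const[of "\<lambda>n. 4 * (\<bar>t\<bar>^n / fact n)"]) (use bound in auto)
  then show "char \<mu> t = char \<nu> t" by simp
qed

text \<open>By independence the \<open>n\<close>-th moment of the product is the product of the
  \<open>n\<close>-th moments. Dividing by the nonzero moment of \<open>G\<close> shows that
  \<open>\<mu>\<close> and \<open>\<nu>\<close> have the same moments, and these determine a law on
  the unit interval.\<close>

lemma distr_mult_cancel:
  fixes G \<mu> \<nu> :: "real measure"
  assumes G: "real_distribution G" "\<And>n. integrable G (\<lambda>s. s^n)" "\<And>n. (\<integral>s. s^n \<partial>G) \<noteq> 0"
    and \<mu>: "real_distribution \<mu>" "AE x in \<mu>. x \<in> {0..1}"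
    and \<nu>: "real_distribution \<nu>" "AE x in \<nu>. x \<in> {0..1}"
    and eq: "distr (G \<Otimes>\<^sub>M \<mu>) borel (\<lambda>(s, x). s * x) = distr (G \<Otimes>\<^sub>M \<nu>) borel (\<lambda>(s, x). s * x)"
  shows "\<mu> = \<nu>"
proof (rule moments_determine_unit_interval_law[OF \<mu> \<nu>])
  fix n :: nat
  have mom: "(\<integral>y. y^n \<partial>distr (G \<Otimes>\<^sub>M \<rho>) borel (\<lambda>(s, x). s * x)) = (\<integral>s. s^n \<partial>G) * (\<integral>x. x^n \<partial>\<rho>)"
    if \<rho>: "real_distribution \<rho>" "AE x in \<rho>. x \<in> {0..1}" for \<rho>
  proof -
    interpret G: real_distribution G by fact
    interpret \<rho>: real_distribution \<rho> by fact
    interpret P: pair_prob_space G \<rho> ..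
    note i = char_unit_interval_approx(2)[OF \<rho>]
    have s: "sets (G \<Otimes>\<^sub>M \<rho>) = sets (borel \<Otimes>\<^sub>M borel)"
      by (intro sets_pair_measure_cong) simp_all
    have m: "(\<lambda>(s, x). s * x) \<in> borel_measurable (G \<Otimes>\<^sub>M \<rho>)"
      "(\<lambda>(s, x). (s * x)^n) \<in> borel_measurable (G \<Otimes>\<^sub>M \<rho>)"
      unfolding measurable_cong_sets[OF s refl] by simp_all
    \<comment> \<open>Integrating \<open>\<bar>s * x\<bar>^n\<close> over \<open>x\<close> leaves
      \<open>\<bar>s\<bar>^n\<close> times a finite absolute moment of \<open>\<rho>\<close>, which
      is integrable under \<open>G\<close>; this justifies the iterated integral below.\<close>
    have I: "integrable (G \<Otimes>\<^sub>M \<rho>) (\<lambda>(s, x). (s * x)^n)"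
      by (rule P.Fubini_integrable[OF m(2)])
        (use i[of n] G(2)[of n, THEN integrable_abs] in
          \<open>auto simp: power_mult_distrib abs_mult intro!: integrable_mult_left integrable_mult_right\<close>)
    have "(\<integral>y. y^n \<partial>distr (G \<Otimes>\<^sub>M \<rho>) borel (\<lambda>(s, x). s * x)) = (\<integral>(s, x). (s * x)^n \<partial>(G \<Otimes>\<^sub>M \<rho>))"
      by (subst integral_distr[OF m(1)]) (simp_all add: case_prod_unfold)
    also have "\<dots> = (\<integral>s. \<integral>x. (s * x)^n \<partial>\<rho> \<partial>G)"
      using P.integral_fst'[OF I] by simp
    also have "\<dots> = (\<integral>s. s^n \<partial>G) * (\<integral>x. x^n \<partial>\<rho>)"
      by (simp add: power_mult_distrib)
    finally show ?thesis .
  qed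
  show "(\<integral>x. x^n \<partial>\<mu>) = (\<integral>x. x^n \<partial>\<nu>)"
    using mom[OF \<mu>] mom[OF \<nu>] G(3)[of n] unfolding eq by simp
qed

section \<open>Regrouping and projecting product measures\<close>

text \<open>Both sides give a set \<open>S\<close> the same iterated integral of its indicator. The
  regrouping allows one map to act jointly on the first two factors while another acts on the
  third.\<close>

lemma distr_pair_assoc:
  assumes "prob_space M\<^sub>1" "prob_space M\<^sub>2" "prob_space M\<^sub>3"
  shows "distr (M\<^sub>1 \<Otimes>\<^sub>M (M\<^sub>2 \<Otimes>\<^sub>M M\<^sub>3)) ((M\<^sub>1 \<Otimes>\<^sub>M M\<^sub>2) \<Otimes>\<^sub>M M\<^sub>3) (\<lambda>(x, y, z). ((x, y), z)) =
    (M\<^sub>1 \<Otimes>\<^sub>M M\<^sub>2) \<Otimes>\<^sub>M M\<^sub>3"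
proof (rule measure_eqI)
  interpret M1: prob_space M\<^sub>1 by fact
  interpret M2: prob_space M\<^sub>2 by fact
  interpret M3: prob_space M\<^sub>3 by fact
  interpret P23: pair_prob_space M\<^sub>2 M\<^sub>3 ..
  fix S assume "S \<in> sets (distr (M\<^sub>1 \<Otimes>\<^sub>M (M\<^sub>2 \<Otimes>\<^sub>M M\<^sub>3)) ((M\<^sub>1 \<Otimes>\<^sub>M M\<^sub>2) \<Otimes>\<^sub>M M\<^sub>3) (\<lambda>(x, y, z). ((x, y), z)))"
  then have [measurable]: "S \<in> sets ((M\<^sub>1 \<Otimes>\<^sub>M M\<^sub>2) \<Otimes>\<^sub>M M\<^sub>3)" by simp
  have "emeasure (distr (M\<^sub>1 \<Otimes>\<^sub>M (M\<^sub>2 \<Otimes>\<^sub>M M\<^sub>3)) ((M\<^sub>1 \<Otimes>\<^sub>M M\<^sub>2) \<Otimes>\<^sub>M M\<^sub>3) (\<lambda>(x, y, z). ((x, y), z))) S =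
      (\<integral>\<^sup>+w. indicator S w \<partial>distr (M\<^sub>1 \<Otimes>\<^sub>M (M\<^sub>2 \<Otimes>\<^sub>M M\<^sub>3)) ((M\<^sub>1 \<Otimes>\<^sub>M M\<^sub>2) \<Otimes>\<^sub>M M\<^sub>3) (\<lambda>(x, y, z). ((x, y), z)))"
    by simp
  also have "\<dots> = (\<integral>\<^sup>+w. (\<lambda>(x, y, z). indicator S ((x, y), z)) w \<partial>(M\<^sub>1 \<Otimes>\<^sub>M (M\<^sub>2 \<Otimes>\<^sub>M M\<^sub>3)))"
    by (subst nn_integral_distr) (simp_all add: case_prod_unfold)
  also have "\<dots> = (\<integral>\<^sup>+x. \<integral>\<^sup>+y. \<integral>\<^sup>+z. indicator S ((x, y), z) \<partial>M\<^sub>3 \<partial>M\<^sub>2 \<partial>M\<^sub>1)"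
    by (subst P23.nn_integral_fst[symmetric], simp, rule nn_integral_cong,
        subst M3.nn_integral_fst[symmetric]) simp_all
  also have "\<dots> = (\<integral>\<^sup>+w. indicator S w \<partial>((M\<^sub>1 \<Otimes>\<^sub>M M\<^sub>2) \<Otimes>\<^sub>M M\<^sub>3))"
    by (subst M3.nn_integral_fst[symmetric], simp, subst M2.nn_integral_fst[symmetric]) simp_all
  finally show "emeasure (distr (M\<^sub>1 \<Otimes>\<^sub>M (M\<^sub>2 \<Otimes>\<^sub>M M\<^sub>3)) ((M\<^sub>1 \<Otimes>\<^sub>M M\<^sub>2) \<Otimes>\<^sub>M M\<^sub>3) (\<lambda>(x, y, z). ((x, y), z))) S =
      emeasure ((M\<^sub>1 \<Otimes>\<^sub>M M\<^sub>2) \<Otimes>\<^sub>M M\<^sub>3) S"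
    by simp
qed simp

lemma distr_pair_snd:
  assumes "prob_space M\<^sub>1" "prob_space M\<^sub>2"
  shows "distr (M\<^sub>1 \<Otimes>\<^sub>M M\<^sub>2) M\<^sub>2 snd = M\<^sub>2"
proof -
  interpret M1: prob_space M\<^sub>1 by fact
  interpret M2: prob_space M\<^sub>2 by fact
  interpret pair_prob_space M\<^sub>1 M\<^sub>2 ..
  have "distr (M\<^sub>1 \<Otimes>\<^sub>M M\<^sub>2) M\<^sub>2 snd = distr (M\<^sub>2 \<Otimes>\<^sub>M M\<^sub>1) M\<^sub>2 fst"
    by (subst distr_pair_swap, subst distr_distr) (simp_all add: comp_def case_prod_unfold)
  then show ?thesis by (simp add: M1.distr_pair_fst)
qed

section \<open>Beta and gamma distributions: supports, total masses and moments\<close>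

lemma measurable_beta_density [measurable]: "beta_density a b \<in> borel_measurable borel"
  unfolding beta_density_def[abs_def] by measurable

lemma measurable_gamma_density [measurable]: "gamma_density a \<in> borel_measurable borel"
  unfolding gamma_density_def[abs_def] by measurable

lemma sets_beta_distribution [simp, measurable_cong]: "sets (beta_distribution a b) = sets borel"
  and space_beta_distribution [simp]: "space (beta_distribution a b) = UNIV"
  by (simp_all add: beta_distribution_def)

lemma sets_gamma_distribution [simp, measurable_cong]: "sets (gamma_distribution a) = sets borel"
  and space_gamma_distribution [simp]: "space (gamma_distribution a) = UNIV"
  by (simp_all add: gamma_distribution_def)

lemma Gamma_real_neq_0: "0 < x \<Longrightarrow> Gamma (x::real) \<noteq> 0"
  by (rule less_imp_neq[symmetric]) (rule Gamma_real_pos)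

lemma Beta_pos: "0 < a \<Longrightarrow> 0 < b \<Longrightarrow> 0 < Beta a (b::real)"
  by (simp add: Beta_def Gamma_real_pos)

lemma beta_density_nonneg: "0 < a \<Longrightarrow> 0 < b \<Longrightarrow> 0 \<le> beta_density a b u"
  using Beta_pos[of a b] by (simp add: beta_density_def)

lemma gamma_density_nonneg: "0 < a \<Longrightarrow> 0 \<le> gamma_density a u"
  using Gamma_real_pos[of a] by (simp add: gamma_density_def)

lemma AE_beta_distribution: "AE x in beta_distribution a b. x \<in> {0..1}"
  unfolding beta_distribution_def by (subst AE_density) (auto simp: beta_density_def)

lemma AE_gamma_distribution: "AE x in gamma_distribution a. 0 < x"
  unfolding gamma_distribution_def by (subst AE_density) (auto simp: gamma_density_def)

lemma real_distribution_beta: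
  assumes "0 < a" "0 < b"
  shows "real_distribution (beta_distribution a b)"
proof -
  have "emeasure (beta_distribution a b) UNIV = (\<integral>\<^sup>+u. ennreal (beta_density a b u) \<partial>lborel)"
    by (simp add: beta_distribution_def emeasure_density)
  \<comment> \<open>Passing from the open to the closed interval changes no value of the integrand:
    at both endpoints one factor is a power of 0, and \<open>0 powr _\<close> is 0.\<close>
  also have "\<dots> = (\<integral>\<^sup>+u. ennreal (1 / Beta a b) *
      ennreal (indicator {0..1} u * (u powr (a - 1) * (1 - u) powr (b - 1))) \<partial>lborel)"
    using Beta_pos[OF assms]
    by (intro nn_integral_cong) (auto simp: beta_density_def indicator_def simp flip: ennreal_mult)
  also have "\<dots> = ennreal (1 / Beta a b) * ennreal (Beta a b)"
    using nn_integral_has_integral_lebesgue[OF _ has_integral_Beta_real[OF assms]]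
    by (subst nn_integral_cmult) (auto simp: mult_ac)
  also have "\<dots> = 1" using Beta_pos[OF assms] by (simp flip: ennreal_mult)
  finally have "prob_space (beta_distribution a b)" by (intro prob_spaceI) simp
  then show ?thesis by (simp add: real_distribution_def real_distribution_axioms_def)
qed

text \<open>The factor \<open>u ^ n\<close> raises the shape from \<open>a\<close> to
  \<open>a + n\<close>, which leaves Euler's integral for \<open>Gamma (a + n)\<close>. The case
  \<open>n = 0\<close> yields the total mass, the general case the moments.\<close>

lemma nn_integral_gamma_distribution_power:
  assumes "0 < a"
  shows "(\<integral>\<^sup>+u. ennreal (u ^ n) \<partial>gamma_distribution a) = ennreal (Gamma (a + n) / Gamma a)"
proof -
  have "(\<integral>\<^sup>+u. ennreal (u ^ n) \<partial>gamma_distribution a) =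
      (\<integral>\<^sup>+u. ennreal (gamma_density a u) * ennreal (u ^ n) \<partial>lborel)"
    unfolding gamma_distribution_def by (subst nn_integral_density) simp_all
  also have "\<dots> = (\<integral>\<^sup>+u. ennreal (1 / Gamma a) *
      ennreal (indicator {0..} u * u powr (a + n - 1) / exp u) \<partial>lborel)"
  proof (rule nn_integral_cong)
    fix u :: real
    have "u powr (a + n - 1) = u powr (a - 1) * u ^ n" if "0 < u"
      using that by (simp add: powr_realpow[symmetric] powr_add[symmetric] algebra_simps)
    \<comment> \<open>For negative \<open>u\<close> the density and the indicator are both 0; at
      \<open>u = 0\<close> the right side vanishes because \<open>0 powr _\<close> is 0.\<close>
    then show "ennreal (gamma_density a u) * ennreal (u ^ n) =
        ennreal (1 / Gamma a) * ennreal (indicator {0..} u * u powr (a + n - 1) / exp u)"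
      using Gamma_real_pos[OF assms]
      by (cases u "0::real" rule: linorder_cases)
        (auto simp: gamma_density_def exp_minus field_simps simp flip: ennreal_mult)
  qed
  also have "\<dots> = ennreal (1 / Gamma a) * ennreal (Gamma (a + n))"
    using assms by (subst nn_integral_cmult) (simp_all add: Gamma_conv_nn_integral_real)
  also have "\<dots> = ennreal (Gamma (a + n) / Gamma a)"
    using assms by (simp add: Gamma_real_nonneg flip: ennreal_mult)
  finally show ?thesis .
qed

lemma real_distribution_gamma:
  assumes "0 < a"
  shows "real_distribution (gamma_distribution a)"
proof -
  have "emeasure (gamma_distribution a) UNIV = 1"
    using nn_integral_gamma_distribution_power[OF assms, of 0] Gamma_real_pos[OF assms] by simp
  then have "prob_space (gamma_distribution a)" by (intro prob_spaceI) simp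
  then show ?thesis by (simp add: real_distribution_def real_distribution_axioms_def)
qed

lemma has_bochner_integral_gamma_distribution_power:
  assumes "0 < a"
  shows "has_bochner_integral (gamma_distribution a) (\<lambda>s. s ^ n) (Gamma (a + n) / Gamma a)"
proof (rule has_bochner_integral_nn_integral)
  \<comment> \<open>Odd powers are negative on the negative half-line, so the sign is controlled
    only on the support.\<close>
  show "AE s in gamma_distribution a. 0 \<le> s ^ n"
    using AE_gamma_distribution by eventually_elim simp
qed (use assms in \<open>simp_all add: nn_integral_gamma_distribution_power Gamma_real_nonneg\<close>)

section \<open>The change of variables \<open>(v, w) = (s * x, s * (1 - x))\<close> from a gamma
  pair to sum and proportion\<close>

text \<open>The leading \<open>s\<close> is the Jacobian. The powers of \<open>s\<close> collect to
  \<open>s powr (a + b - 1)\<close>, the exponentials to \<open>exp (- s)\<close>, and the constants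
  match because \<open>Beta a b = Gamma a * Gamma b / Gamma (a + b)\<close>.\<close>

lemma gamma_density_beta_density:
  assumes "0 < a" "0 < b" "0 < s"
  shows "s * (gamma_density a (s * x) * gamma_density b (s * (1 - x))) =
    gamma_density (a + b) s * beta_density a b x"
proof (cases "0 < x \<and> x < 1")
  case True
  have G: "Gamma (a + b) \<noteq> 0"
    using assms by (intro Gamma_real_neq_0) simp
  have "s * (s powr (a - 1) * s powr (b - 1)) = s powr 1 * s powr (a - 1) * s powr (b - 1)"
    using assms by simp
  also have "\<dots> = s powr (a + b - 1)"
    unfolding powr_add[symmetric] by (simp add: algebra_simps)
  finally have p: "s * (s powr (a - 1) * s powr (b - 1)) = s powr (a + b - 1)" .
  have e: "exp (- (s * x)) * exp (- (s * (1 - x))) = exp (- s)"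
    unfolding exp_add[symmetric] by (simp add: algebra_simps)
  have "s * (gamma_density a (s * x) * gamma_density b (s * (1 - x))) =
      (s * (s powr (a - 1) * s powr (b - 1))) * (x powr (a - 1) * (1 - x) powr (b - 1)) *
      (exp (- (s * x)) * exp (- (s * (1 - x)))) / (Gamma a * Gamma b)"
    using True assms by (simp add: gamma_density_def powr_mult)
  also have "\<dots> = gamma_density (a + b) s * beta_density a b x"
    unfolding p e using True assms G
    by (simp add: gamma_density_def beta_density_def Beta_def)
  finally show ?thesis .
next
  \<comment> \<open>As \<open>s\<close> is positive, one of \<open>s * x\<close> and
    \<open>s * (1 - x)\<close> is not positive, so a gamma density vanishes together with the beta
    density.\<close>
  case False
  then show ?thesis
    using assms by (auto simp: gamma_density_def beta_density_def zero_less_mult_iff)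
qed

text \<open>The planar substitution is carried out on iterated integrals in one-dimensional steps: a
  shift, an exchange of the order of integration, and a scaling; then the density identity above
  applies.\<close>

lemma gamma_pair_conv_gamma_beta:
  assumes a: "0 < a" and b: "0 < b"
  shows "distr (gamma_distribution (a + b) \<Otimes>\<^sub>M beta_distribution a b) (borel \<Otimes>\<^sub>M borel)
      (\<lambda>(s, x). (s * x, s * (1 - x))) = gamma_distribution a \<Otimes>\<^sub>M gamma_distribution b"
    (is "distr ?P _ ?T = ?Q")
proof (rule measure_eqI)
  have ab: "0 < a + b" using a b by simp
  interpret G: real_distribution "gamma_distribution b" by (rule real_distribution_gamma[OF b])
  interpret B: real_distribution "beta_distribution a b" by (rule real_distribution_beta[OF a b])
  show "sets (distr ?P (borel \<Otimes>\<^sub>M borel) ?T) = sets ?Q"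
    by (simp cong: sets_pair_measure_cong)
  fix S assume "S \<in> sets (distr ?P (borel \<Otimes>\<^sub>M borel) ?T)"
  then have S [measurable]: "S \<in> sets (borel \<Otimes>\<^sub>M borel)" by simp
  have SQ: "S \<in> sets ?Q" using S by (simp cong: sets_pair_measure_cong)
  let ?I = "\<lambda>v w. indicator S (v, w) :: ennreal"
  let ?g = "\<lambda>v w. ennreal (gamma_density a v * gamma_density b w)"
  have "emeasure ?Q S = (\<integral>\<^sup>+v. \<integral>\<^sup>+w. ?I v w \<partial>gamma_distribution b \<partial>gamma_distribution a)"
    by (rule G.emeasure_pair_measure[OF SQ])
  also have "\<dots> = (\<integral>\<^sup>+v. \<integral>\<^sup>+w. ?g v w * ?I v w \<partial>lborel \<partial>lborel)"
    unfolding gamma_distribution_def using a b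
    by (subst (1 2) nn_integral_density)
      (auto simp: gamma_density_nonneg ennreal_mult mult.assoc simp flip: nn_integral_cmult)
  \<comment> \<open>For fixed \<open>v\<close> substitute \<open>w = s - v\<close>, which makes the
    sum \<open>s\<close> a variable of integration.\<close>
  also have "\<dots> = (\<integral>\<^sup>+v. \<integral>\<^sup>+s. ?g v (s - v) * ?I v (s - v) \<partial>lborel \<partial>lborel)"
  proof (rule nn_integral_cong)
    fix v :: real
    show "(\<integral>\<^sup>+w. ?g v w * ?I v w \<partial>lborel) = (\<integral>\<^sup>+s. ?g v (s - v) * ?I v (s - v) \<partial>lborel)"
      by (subst nn_integral_real_affine[where c = 1 and t = "- v"]) simp_all
  qed
  also have "\<dots> = (\<integral>\<^sup>+s. \<integral>\<^sup>+v. ?g v (s - v) * ?I v (s - v) \<partial>lborel \<partial>lborel)"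
    by (rule lborel_pair.Fubini') simp
  also have "\<dots> = (\<integral>\<^sup>+s. \<integral>\<^sup>+x. ennreal (gamma_density (a + b) s) *
      (ennreal (beta_density a b x) * ?I (s * x) (s * (1 - x))) \<partial>lborel \<partial>lborel)"
  proof (rule nn_integral_cong)
    fix s :: real
    show "(\<integral>\<^sup>+v. ?g v (s - v) * ?I v (s - v) \<partial>lborel) =
      (\<integral>\<^sup>+x. ennreal (gamma_density (a + b) s) *
        (ennreal (beta_density a b x) * ?I (s * x) (s * (1 - x))) \<partial>lborel)"
    proof (cases "0 < s")
      case True
      \<comment> \<open>For fixed \<open>s\<close> substitute \<open>v = s * x\<close>; the factor
        \<open>\<bar>s\<bar>\<close> becomes the Jacobian of the density identity.\<close>
      have "(\<integral>\<^sup>+v. ?g v (s - v) * ?I v (s - v) \<partial>lborel) =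
          ennreal \<bar>s\<bar> * (\<integral>\<^sup>+x. ?g (0 + s * x) (s - (0 + s * x)) * ?I (0 + s * x) (s - (0 + s * x)) \<partial>lborel)"
        using True by (intro nn_integral_real_affine) simp_all
      also have "\<dots> = (\<integral>\<^sup>+x. ennreal (s * (gamma_density a (s * x) * gamma_density b (s * (1 - x)))) *
          ?I (s * x) (s * (1 - x)) \<partial>lborel)"
        using True a b
        by (subst nn_integral_cmult[symmetric])
          (auto simp: ennreal_mult gamma_density_nonneg mult.assoc right_diff_distrib)
      finally show ?thesis
        unfolding gamma_density_beta_density[OF a b True]
        using gamma_density_nonneg[OF ab] beta_density_nonneg[OF a b]
        by (simp add: ennreal_mult mult.assoc)
    next
      case False
      \<comment> \<open>If \<open>s\<close> is not positive, then \<open>v\<close> and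
        \<open>s - v\<close> cannot both be positive.\<close>
      then have "?g v (s - v) = 0" for v
        by (auto simp: gamma_density_def)
      moreover have "gamma_density (a + b) s = 0"
        using False by (simp add: gamma_density_def)
      ultimately show ?thesis by simp
    qed
  qed
  also have "\<dots> = (\<integral>\<^sup>+s. \<integral>\<^sup>+x. ?I (s * x) (s * (1 - x)) \<partial>beta_distribution a b \<partial>gamma_distribution (a + b))"
    unfolding gamma_distribution_def beta_distribution_def
    by (subst (1 2) nn_integral_density) (simp_all flip: nn_integral_cmult)
  also have "\<dots> = (\<integral>\<^sup>+p. indicator S (?T p) \<partial>?P)"
    by (subst B.nn_integral_fst[symmetric]) simp_all
  also have "\<dots> = (\<integral>\<^sup>+p. indicator S p \<partial>distr ?P (borel \<Otimes>\<^sub>M borel) ?T)"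
    by (rule nn_integral_distr[symmetric]) simp_all
  also have "\<dots> = emeasure (distr ?P (borel \<Otimes>\<^sub>M borel) ?T) S"
    by simp
  finally show "emeasure (distr ?P (borel \<Otimes>\<^sub>M borel) ?T) S = emeasure ?Q S" by simp
qed

section \<open>Equivalence of the two distributional equations on one product space\<close>

theorem proposition1:
  fixes M :: "'w measure" and A B :: "'w \<Rightarrow> real" and a b :: real
  assumes "prob_space M"
    and "A \<in> borel_measurable M" and "B \<in> borel_measurable M"
    and "\<And>\<omega>. \<omega> \<in> space M \<Longrightarrow> A \<omega> \<in> {0..1} \<and> B \<omega> \<in> {0..1}"
    and "0 < a" and "0 < b"
  shows "has_solution_law (distr M borel (\<lambda>\<omega>. (A \<omega>, B \<omega>))) (beta_distribution a b) \<longleftrightarrow>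
    gamma_type_relation (distr M borel (\<lambda>\<omega>. (A \<omega>, B \<omega>)))
      (gamma_distribution a \<Otimes>\<^sub>M gamma_distribution b)"
proof -
  have ab: "0 < a + b" using assms by simp
  let ?\<beta> = "beta_distribution a b" and ?\<Gamma> = "gamma_distribution (a + b)"
  let ?\<Gamma>a = "gamma_distribution a" and ?\<Gamma>b = "gamma_distribution b"
  let ?AB = "\<lambda>\<omega>. (A \<omega>, B \<omega>)"
  let ?\<nu> = "distr M borel ?AB"
  \<comment> \<open>A point of \<open>?Q\<close> consists of a beta variable \<open>X\<close> and a
    sample point carrying \<open>(A, B)\<close>; \<open>?P\<close> adds an independent scale
    \<open>S\<close> with law \<open>?\<Gamma>\<close>. Here \<open>?Y\<close> is the right side of
    the beta equation, and \<open>?V1\<close>, \<open>?V2\<close> are \<open>S * X\<close> and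
    \<open>S * (1 - X)\<close>.\<close>
  let ?Q = "?\<beta> \<Otimes>\<^sub>M M"
  let ?P = "?\<Gamma> \<Otimes>\<^sub>M ?Q"
  let ?Y = "\<lambda>q. A (snd q) * fst q + B (snd q) * (1 - fst q)"
  let ?V1 = "\<lambda>p. fst p * fst (snd p)" and ?V2 = "\<lambda>p. fst p * (1 - fst (snd p))"
  let ?A = "\<lambda>p. A (snd (snd p))" and ?B = "\<lambda>p. B (snd (snd p))"
  note [measurable] = assms(2,3)
  interpret M: prob_space M by fact
  interpret \<beta>: real_distribution ?\<beta> using assms by (intro real_distribution_beta)
  interpret \<Gamma>: real_distribution ?\<Gamma> using ab by (intro real_distribution_gamma)
  interpret \<Gamma>a: real_distribution ?\<Gamma>a using assms by (intro real_distribution_gamma)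
  interpret \<Gamma>b: real_distribution ?\<Gamma>b using assms by (intro real_distribution_gamma)
  interpret Q: pair_prob_space ?\<beta> M ..
  interpret P: pair_prob_space ?\<Gamma> ?Q ..
  interpret \<Gamma>ab: pair_prob_space ?\<Gamma>a ?\<Gamma>b ..
  interpret \<Gamma>\<beta>: pair_prob_space ?\<Gamma> ?\<beta> ..
  have pm [measurable]: "?AB \<in> borel_measurable M" by (simp flip: borel_prod)
  interpret \<nu>: prob_space ?\<nu> by (rule M.prob_space_distr) (rule pm)

  have X: "distr ?Q borel fst = ?\<beta>"
    using M.distr_pair_fst[of ?\<beta>] by (simp cong: distr_cong)
  have Q_snd: "distr ?Q M snd = M"
    by (rule distr_pair_snd) (rule \<beta>.prob_space_axioms M.prob_space_axioms)+
  have P_snd: "distr ?P ?Q snd = ?Q"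
    by (rule distr_pair_snd) (rule \<Gamma>.prob_space_axioms Q.prob_space_axioms)+
  have Q_AB: "distr ?Q borel (\<lambda>q. ?AB (snd q)) = ?\<nu>"
    by (subst (2) Q_snd[symmetric], subst distr_distr) (simp_all add: comp_def pm)
  have P_AB: "distr ?P borel (\<lambda>p. ?AB (snd (snd p))) = ?\<nu>"
    unfolding Q_AB[symmetric]
    by (subst (2) P_snd[symmetric], subst distr_distr)
      (simp_all add: comp_def measurable_compose[OF measurable_snd pm])

  \<comment> \<open>With independence on this concrete space, \<open>has_solution_law_iff\<close>
    replaces the existential definition by an equality of two laws on \<open>?Q\<close>.\<close>
  have "Q.indep_set (generated_sigma ?Q fst) (generated_sigma ?Q (\<lambda>q. ?AB (snd q)))"
  proof (subst Q.indep_set_generated_sigma_iff)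
    have "?\<beta> \<Otimes>\<^sub>M ?\<nu> = distr ?Q (borel \<Otimes>\<^sub>M borel) (\<lambda>(x, y). (x, ?AB y))"
      using pair_measure_distr[of "\<lambda>x. x" ?\<beta> ?\<beta> ?AB M borel] \<nu>.sigma_finite_measure_axioms
      by (simp add: pm distr_id2 cong: distr_cong sets_pair_measure_cong)
    then show "distr ?Q borel (\<lambda>q. (fst q, ?AB (snd q))) =
        distr ?Q borel fst \<Otimes>\<^sub>M distr ?Q borel (\<lambda>q. ?AB (snd q))"
      unfolding X Q_AB by (simp add: borel_prod case_prod_unfold)
  qed (simp_all add: measurable_compose[OF measurable_snd pm])
  then have beta_iff: "has_solution_law ?\<nu> ?\<beta> \<longleftrightarrow> distr ?Q borel fst = distr ?Q borel ?Y"
    using has_solution_law_iff[of ?Q "\<lambda>q. A (snd q)" "\<lambda>q. B (snd q)" fst] Q.prob_space_axioms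
    by (simp add: X Q_AB)

  \<comment> \<open>After regrouping to \<open>((S, X), \<omega>)\<close>, the map \<open>?T\<close>
    acts on the pair and \<open>?AB\<close> on the sample point, so the image is again a product,
    with first factor given by \<open>gamma_pair_conv_gamma_beta\<close>.\<close>
  have P_law: "distr ?P ((borel \<Otimes>\<^sub>M borel) \<Otimes>\<^sub>M borel) (\<lambda>p. ((?V1 p, ?V2 p), ?AB (snd (snd p)))) =
      (?\<Gamma>a \<Otimes>\<^sub>M ?\<Gamma>b) \<Otimes>\<^sub>M ?\<nu>"
  proof -
    let ?T = "\<lambda>(s, x). (s * x, s * (1 - x)) :: real \<times> real"
    have T: "?T \<in> ?\<Gamma> \<Otimes>\<^sub>M ?\<beta> \<rightarrow>\<^sub>M borel \<Otimes>\<^sub>M borel" by measurable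
    have "distr ?P ((borel \<Otimes>\<^sub>M borel) \<Otimes>\<^sub>M borel) (\<lambda>p. ((?V1 p, ?V2 p), ?AB (snd (snd p)))) =
        distr (distr ?P ((?\<Gamma> \<Otimes>\<^sub>M ?\<beta>) \<Otimes>\<^sub>M M) (\<lambda>(x, y, z). ((x, y), z)))
          ((borel \<Otimes>\<^sub>M borel) \<Otimes>\<^sub>M borel) (\<lambda>(u, \<omega>). (?T u, ?AB \<omega>))"
      using T pm by (subst distr_distr) (simp_all add: comp_def case_prod_unfold)
    also have "\<dots> = distr ((?\<Gamma> \<Otimes>\<^sub>M ?\<beta>) \<Otimes>\<^sub>M M) ((borel \<Otimes>\<^sub>M borel) \<Otimes>\<^sub>M borel) (\<lambda>(u, \<omega>). (?T u, ?AB \<omega>))"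
      by (subst distr_pair_assoc)
        (rule refl \<Gamma>.prob_space_axioms \<beta>.prob_space_axioms M.prob_space_axioms)+
    also have "\<dots> = distr (?\<Gamma> \<Otimes>\<^sub>M ?\<beta>) (borel \<Otimes>\<^sub>M borel) ?T \<Otimes>\<^sub>M ?\<nu>"
      by (rule pair_measure_distr[symmetric]) (rule T pm \<nu>.sigma_finite_measure_axioms)+
    finally show ?thesis
      unfolding gamma_pair_conv_gamma_beta[OF assms(5,6)] .
  qed
  have m3: "(\<lambda>p. ((?V1 p, ?V2 p), ?AB (snd (snd p)))) \<in> ?P \<rightarrow>\<^sub>M (borel \<Otimes>\<^sub>M borel) \<Otimes>\<^sub>M borel"
    using measurable_compose[OF measurable_snd measurable_compose[OF measurable_snd pm]] by simp
  have Pm: "?V1 \<in> borel_measurable ?P" "?V2 \<in> borel_measurable ?P"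
    "(\<lambda>p. (?A p, ?B p)) \<in> borel_measurable ?P"
    using measurable_compose[OF measurable_snd measurable_compose[OF measurable_snd pm]] by simp_all
  \<comment> \<open>Events in the three generated sigma-algebras meet in preimages of rectangles,
    whose probabilities \<open>P_law\<close> factorizes.\<close>
  have rect: "P.prob ((?V1 -` C \<inter> space ?P) \<inter> ((?V2 -` D \<inter> space ?P) \<inter> ((\<lambda>p. (?A p, ?B p)) -` E \<inter> space ?P))) =
      measure ?\<Gamma>a C * (measure ?\<Gamma>b D * measure ?\<nu> E)"
    if "C \<in> sets borel" "D \<in> sets borel" "E \<in> sets borel" for C D E
  proof -
    have "P.prob ((?V1 -` C \<inter> space ?P) \<inter> ((?V2 -` D \<inter> space ?P) \<inter> ((\<lambda>p. (?A p, ?B p)) -` E \<inter> space ?P))) =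
        measure (distr ?P ((borel \<Otimes>\<^sub>M borel) \<Otimes>\<^sub>M borel) (\<lambda>p. ((?V1 p, ?V2 p), ?AB (snd (snd p))))) ((C \<times> D) \<times> E)"
      using that by (subst measure_distr[OF m3]) (auto intro!: arg_cong[where f = P.prob])
    also have "\<dots> = measure ?\<Gamma>a C * (measure ?\<Gamma>b D * measure ?\<nu> E)"
      unfolding P_law measure_def using that
      by (simp add: \<nu>.emeasure_pair_measure_Times \<Gamma>b.emeasure_pair_measure_Times enn2real_mult mult.assoc)
    finally show ?thesis .
  qed
  have "P.indep_sets (\<lambda>i. [generated_sigma ?P ?V1, generated_sigma ?P ?V2,
      generated_sigma ?P (\<lambda>p. (?A p, ?B p))] ! i) {..<3}"
  proof (subst P.indep_sets3_iff)
    have un: "measure ?\<Gamma>a UNIV = 1" "measure ?\<Gamma>b UNIV = 1" "measure ?\<nu> UNIV = 1"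
      using \<Gamma>a.prob_space \<Gamma>b.prob_space \<nu>.prob_space by simp_all
    show "\<forall>S\<^sub>1\<in>generated_sigma ?P ?V1. \<forall>S\<^sub>2\<in>generated_sigma ?P ?V2.
        \<forall>S\<^sub>3\<in>generated_sigma ?P (\<lambda>p. (?A p, ?B p)).
          P.prob (S\<^sub>1 \<inter> (S\<^sub>2 \<inter> S\<^sub>3)) = P.prob S\<^sub>1 * (P.prob S\<^sub>2 * P.prob S\<^sub>3)"
    proof (intro ballI)
      fix S1 S2 S3 assume "S1 \<in> generated_sigma ?P ?V1" "S2 \<in> generated_sigma ?P ?V2"
        "S3 \<in> generated_sigma ?P (\<lambda>p. (?A p, ?B p))"
      then obtain C D E where S: "C \<in> sets borel" "D \<in> sets borel" "E \<in> sets borel"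
        "S1 = ?V1 -` C \<inter> space ?P" "S2 = ?V2 -` D \<inter> space ?P" "S3 = (\<lambda>p. (?A p, ?B p)) -` E \<inter> space ?P"
        unfolding sets_generated_sigma by blast
      \<comment> \<open>Taking two of the three sides to be \<open>UNIV\<close> identifies the
        individual probabilities with the factors.\<close>
      show "P.prob (S1 \<inter> (S2 \<inter> S3)) = P.prob S1 * (P.prob S2 * P.prob S3)"
        using rect[of C D E] rect[of C UNIV UNIV] rect[of UNIV D UNIV] rect[of UNIV UNIV E] S
        by (simp add: un Int_absorb1 Int_assoc)
    qed
  qed (use Pm[THEN measurable_sets] in \<open>auto simp: sets_generated_sigma intro: exI[of _ UNIV]\<close>)
  moreover have "distr ?P (borel \<Otimes>\<^sub>M borel) (\<lambda>p. (?V1 p, ?V2 p)) = ?\<Gamma>a \<Otimes>\<^sub>M ?\<Gamma>b"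
  proof -
    have "distr ?P (borel \<Otimes>\<^sub>M borel) (\<lambda>p. (?V1 p, ?V2 p)) =
        distr ((?\<Gamma>a \<Otimes>\<^sub>M ?\<Gamma>b) \<Otimes>\<^sub>M ?\<nu>) (borel \<Otimes>\<^sub>M borel) fst"
      unfolding P_law[symmetric] using m3 by (subst distr_distr) (simp_all add: comp_def)
    also have "\<dots> = distr ((?\<Gamma>a \<Otimes>\<^sub>M ?\<Gamma>b) \<Otimes>\<^sub>M ?\<nu>) (?\<Gamma>a \<Otimes>\<^sub>M ?\<Gamma>b) fst"
      by (intro distr_cong) (simp_all cong: sets_pair_measure_cong)
    finally show ?thesis by (simp add: \<nu>.distr_pair_fst)
  qed
  \<comment> \<open>The scale \<open>S\<close> is common to \<open>?V1\<close> and
    \<open>?V2\<close> and comes out as a factor.\<close>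
  moreover have "(\<lambda>p. ?A p * ?V1 p + ?B p * ?V2 p) = (\<lambda>p. fst p * ?Y (snd p))"
    by (simp add: algebra_simps)
  ultimately have gamma_iff: "gamma_type_relation ?\<nu> (?\<Gamma>a \<Otimes>\<^sub>M ?\<Gamma>b) \<longleftrightarrow>
      distr ?P borel ?V1 = distr ?P borel (\<lambda>p. fst p * ?Y (snd p))"
    using gamma_type_relation_iff[of ?P ?A ?B ?V1 ?V2] P.prob_space_axioms
    by (simp add: P_AB)

  \<comment> \<open>Since \<open>f\<close> is independent of the scale, the law of the product
    depends on \<open>f\<close> only through its law. This brings both sides of the gamma relation
    into the form that \<open>distr_mult_cancel\<close> handles, and also gives the
    converse.\<close>
  have P_mult: "distr ?P borel (\<lambda>p. fst p * f (snd p)) =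
      distr (?\<Gamma> \<Otimes>\<^sub>M distr ?Q borel f) borel (\<lambda>(s, x). s * x)"
    if f [measurable]: "f \<in> borel_measurable ?Q" for f
  proof -
    interpret f: prob_space "distr ?Q borel f" by (rule Q.prob_space_distr) (rule f)
    have "?\<Gamma> \<Otimes>\<^sub>M distr ?Q borel f = distr ?P (?\<Gamma> \<Otimes>\<^sub>M borel) (\<lambda>(s, q). (s, f q))"
      using pair_measure_distr[of "\<lambda>s. s" ?\<Gamma> ?\<Gamma> f ?Q borel] f.sigma_finite_measure_axioms f
      by (simp add: distr_id2)
    then show ?thesis
      by (simp add: distr_distr comp_def case_prod_unfold)
  qed
  \<comment> \<open>\<open>?Y\<close> is a convex combination of \<open>A\<close> and
    \<open>B\<close> with weights \<open>X\<close> and \<open>1 - X\<close>.\<close>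
  have Y_unit: "?Y q \<in> {0..1}" if "fst q \<in> {0..1}" "snd q \<in> space M" for q
  proof -
    have "A (snd q) * fst q + B (snd q) * (1 - fst q) \<le> 1 * fst q + 1 * (1 - fst q)"
      using that assms(4)[OF that(2)] by (intro add_mono mult_right_mono) auto
    then show ?thesis using that assms(4)[OF that(2)] by simp
  qed
  have "distr ?P borel ?V1 = distr ?P borel (\<lambda>p. fst p * ?Y (snd p)) \<longleftrightarrow>
      distr ?Q borel fst = distr ?Q borel ?Y"
  proof
    assume eq: "distr ?P borel ?V1 = distr ?P borel (\<lambda>p. fst p * ?Y (snd p))"
    show "distr ?Q borel fst = distr ?Q borel ?Y"
    proof (rule distr_mult_cancel)
      note m = has_bochner_integral_gamma_distribution_power[OF ab]
      show "real_distribution ?\<Gamma>" by (rule \<Gamma>.real_distribution_axioms)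
      show "integrable ?\<Gamma> (\<lambda>s. s^n)" for n
        using m by (auto simp: has_bochner_integral_iff)
      show "(\<integral>s. s^n \<partial>?\<Gamma>) \<noteq> 0" for n
        using has_bochner_integral_integral_eq[OF m, of n] Gamma_real_neq_0[OF ab]
          Gamma_real_neq_0[of "a + b + n"] ab by simp
      show "real_distribution (distr ?Q borel fst)" "real_distribution (distr ?Q borel ?Y)"
        by (simp_all add: Q.real_distribution_distr)
      show "AE x in distr ?Q borel fst. x \<in> {0..1}"
        unfolding X by (rule AE_beta_distribution)
      \<comment> \<open>The support of the beta law is pulled back to \<open>?Q\<close>, where
        \<open>Y_unit\<close> applies almost everywhere, and the bound is then pushed forward to the
        law of \<open>?Y\<close>.\<close>
      then have "AE q in ?Q. fst q \<in> {0..1}"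
        by (subst (asm) AE_distr_iff) simp_all
      moreover have "AE q in ?Q. snd q \<in> space M"
        by (rule AE_I2) (auto simp: space_pair_measure)
      ultimately have "AE q in ?Q. ?Y q \<in> {0..1}"
        by eventually_elim (rule Y_unit)
      then show "AE x in distr ?Q borel ?Y. x \<in> {0..1}"
        by (subst AE_distr_iff) simp_all
    qed (use eq P_mult[of fst] P_mult[of ?Y] in simp)
  next
    assume "distr ?Q borel fst = distr ?Q borel ?Y"
    then show "distr ?P borel ?V1 = distr ?P borel (\<lambda>p. fst p * ?Y (snd p))"
      using P_mult[of fst] P_mult[of ?Y] by simp
  qed
  with beta_iff gamma_iff show ?thesis by simp
qed

end
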